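(* Let $\mathbb F$ be a field, let $0\neq q\in\mathbb F$ be not a root of unity, and let $\mathcal U^+_q$ be the alternating central extension of $U^+_q$. Then, over $\mathcal U^+_q$, $$\mathcal Z^\vee(t) =-(q-q^{-1})\, \mathcal {\tilde G}(q^{-1}t)\, E(\xi t)\, \mathcal {\tilde G}(qt),$$ where $\xi=-q^2(q-q^{-1})^{-2}$.
   Context: Algebras are associative, unital, over $\mathbb F$. For elements $X,Y$ of an algebra and $0\ne p\in\mathbb F$: $[X,Y]=XY-YX$, $[X,Y]_p=pXY-p^{-1}YX$. $\mathbb N=\{0,1,2,\ldots\}$. Generating functions over an algebra are formal power series in a commuting indeterminate $t$. The algebra $\mathcal U^+_q$ is defined by generators $\{\mathcal W_{-k}\}_{k\in\mathbb N}$, $\{\mathcal W_{k+1}\}_{k\in\mathbb N}$, $\{\mathcal G_{k+1}\}_{k\in\mathbb N}$, $\{\mathcal{\tilde G}_{k+1}\}_{k\in\mathbb N}$ and the relations, for all $k,\ell\in\mathbb N$: $[\mathcal W_0,\mathcal W_{k+1}]=[\mathcal W_{-k},\mathcal W_1]=(1-q^{-2})(\mathcal{\tilde G}_{k+1}-\mathcal G_{k+1})$; $[\mathcal W_0,\mathcal G_{k+1}]_q=[\mathcal{\tilde G}_{k+1},\mathcal W_0]_q=(q-q^{-1})\mathcal W_{-k-1}$; $[\mathcal G_{k+1},\mathcal W_1]_q=[\mathcal W_1,\mathcal{\tilde G}_{k+1}]_q=(q-q^{-1})\mathcal W_{k+2}$; $[\mathcal W_{-k},\mathcal W_{-\ell}]=0$,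 $[\mathcal W_{k+1},\mathcal W_{\ell+1}]=0$; $[\mathcal W_{-k},\mathcal W_{\ell+1}]+[\mathcal W_{k+1},\mathcal W_{-\ell}]=0$; $[\mathcal W_{-k},\mathcal G_{\ell+1}]+[\mathcal G_{k+1},\mathcal W_{-\ell}]=0$; $[\mathcal W_{-k},\mathcal{\tilde G}_{\ell+1}]+[\mathcal{\tilde G}_{k+1},\mathcal W_{-\ell}]=0$; $[\mathcal W_{k+1},\mathcal G_{\ell+1}]+[\mathcal G_{k+1},\mathcal W_{\ell+1}]=0$; $[\mathcal W_{k+1},\mathcal{\tilde G}_{\ell+1}]+[\mathcal{\tilde G}_{k+1},\mathcal W_{\ell+1}]=0$; $[\mathcal G_{k+1},\mathcal G_{\ell+1}]=0$, $[\mathcal{\tilde G}_{k+1},\mathcal{\tilde G}_{\ell+1}]=0$; $[\mathcal{\tilde G}_{k+1},\mathcal G_{\ell+1}]+[\mathcal G_{k+1},\mathcal{\tilde G}_{\ell+1}]=0$. Put $\mathcal G_0=\mathcal{\tilde G}_0=1$, and $\mathcal{\tilde G}(t)=\sum_{n\in\mathbb N}\mathcal{\tilde G}_nt^n$. Set $\mathcal Z^\vee_0=1$ and, for $n\ge1$, $\mathcal Z^\vee_n=\sum_{k=0}^n\mathcal G_k\mathcal{\tilde G}_{n-k}q^{n-2k}-q\sum_{k=0}^{n-1}\mathcal W_{-k}\mathcal W_{n-k}q^{n-1-2k}$; $\mathcal Z^\vee(t)=\sum_{n\in\mathbb N}\mathcal Z^\vee_nt^n$. $U^+_q$ is the algebra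 with generators $W_0,W_1$ and relations $[W_0,[W_0,[W_0,W_1]_q]_{q^{-1}}]=0$, $[W_1,[W_1,[W_1,W_0]_q]_{q^{-1}}]=0$. There is an injective algebra homomorphism $U^+_q\to\mathcal U^+_q$, $W_0\mapsto\mathcal W_0$, $W_1\mapsto\mathcal W_1$, by which $U^+_q$ is identified with the subalgebra of $\mathcal U^+_q$ generated by $\mathcal W_0,\mathcal W_1$. Damiani's elements of $U^+_q$ (viewed in $\mathcal U^+_q$) are defined recursively by $E_{\alpha_0}=W_0$, $E_{\alpha_1}=W_1$, $E_\delta=q^{-2}W_1W_0-W_0W_1$ and, for $n\ge1$, $E_{n\delta+\alpha_0}=\frac{[E_\delta,E_{(n-1)\delta+\alpha_0}]}{q+q^{-1}}$, $E_{n\delta+\alpha_1}=\frac{[E_{(n-1)\delta+\alpha_1},E_\delta]}{q+q^{-1}}$, $E_{n\delta}=q^{-2}E_{(n-1)\delta+\alpha_1}W_0-W_0E_{(n-1)\delta+\alpha_1}$; also $E_{0\delta}=-(q-q^{-1})^{-1}$. Set $E(t)=\sum_{n\in\mathbb N}E_{n\delta}t^n$. *)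

theory Defs
  imports "HOL-Library.Poly_Mapping" "HOL-Algebra.QuotRing" "HOL-Algebra.Module"
begin

section \<open>Algebras given by generators and relations\<close>

text \<open>An algebra over a field \<open>'f\<close> is represented by the ring record with scalar multiplication
  \<^type>\<open>module\<close>. (The locale \<^locale>\<open>algebra\<close> is not usable here: it demands commutativity.)

  The free algebra on a set of letters is the monoid algebra of the free monoid: finitely supported
  functions on words, with convolution as product. The free monoid is a copy of the type of lists,
  so that no additive structure is imposed on lists themselves.\<close>

datatype 'g freeword = Word (letters: "'g list")

instantiation freeword :: (type) monoid_add
begin

definition zero_freeword :: "'a freeword"
  where "0 = Word []"

definition plus_freeword :: "'a freeword \<Rightarrow> 'a freeword \<Rightarrow> 'a freeword"
  where "u + v = Word (letters u @ letters v)"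

instance
  by standard (simp_all add: zero_freeword_def plus_freeword_def)

end

type_synonym ('g, 'f) free = "'g freeword \<Rightarrow>\<^sub>0 'f"

definition free_algebra :: "('f::field, ('g, 'f) free) module"
  where "free_algebra =
    \<lparr>carrier = UNIV, mult = (*), one = 1, zero = 0, add = (+),
     smult = (\<lambda>c. Poly_Mapping.map ((*) c))\<rparr>"

definition generator :: "'g \<Rightarrow> ('g, 'f::field) free"
  where "generator x = Poly_Mapping.single (Word [x]) 1"

definition quotient_algebra :: "('f, 'a) module \<Rightarrow> 'a set \<Rightarrow> ('f, 'a set) module"
  where "quotient_algebra A I =
    \<lparr>carrier = carrier (A Quot I), mult = mult (A Quot I), one = one (A Quot I),
     zero = zero (A Quot I), add = add (A Quot I),
     smult = (\<lambda>c X. \<Union>x\<in>X. I +>\<^bsub>A\<^esub> (c \<odot>\<^bsub>A\<^esub> x))\<rparr>"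

text \<open>A pair \<open>(x, y)\<close> stands for the relation \<open>x = y\<close>. Note that \<^const>\<open>genideal\<close> is the two-sided
  ideal generated by a set.\<close>

definition relation_ideal :: "(('g, 'f::field) free \<times> ('g, 'f) free) set \<Rightarrow> ('g, 'f) free set"
  where "relation_ideal R = Idl\<^bsub>free_algebra\<^esub> {x \<ominus>\<^bsub>free_algebra\<^esub> y | x y. (x, y) \<in> R}"

definition presented_algebra ::
    "(('g, 'f::field) free \<times> ('g, 'f) free) set \<Rightarrow> ('f, ('g, 'f) free set) module"
  where "presented_algebra R = quotient_algebra free_algebra (relation_ideal R)"


section \<open>Commutators\<close>

definition comm :: "('f, 'a) module \<Rightarrow> 'a \<Rightarrow> 'a \<Rightarrow> 'a"
  where "comm A x y = x \<otimes>\<^bsub>A\<^esub> y \<ominus>\<^bsub>A\<^esub> y \<otimes>\<^bsub>A\<^esub> x"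

definition qcomm :: "('f::field, 'a) module \<Rightarrow> 'f \<Rightarrow> 'a \<Rightarrow> 'a \<Rightarrow> 'a"
  where "qcomm A p x y = p \<odot>\<^bsub>A\<^esub> (x \<otimes>\<^bsub>A\<^esub> y) \<ominus>\<^bsub>A\<^esub> inverse p \<odot>\<^bsub>A\<^esub> (y \<otimes>\<^bsub>A\<^esub> x)"


section \<open>The alternating central extension of \<open>U\<^sup>+\<^sub>q\<close>\<close>

text \<open>\<open>Gen_W j\<close>, with \<open>j\<close> an arbitrary integer, is the generator \<open>\<W>\<^sub>j\<close> and so covers both families
  \<open>\<W>\<^bsub>-k\<^esub>\<close> and \<open>\<W>\<^bsub>k+1\<^esub>\<close> with \<open>k\<close> a natural number. Mind the shift in the other letters: \<open>Gen_G k\<close>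
  is \<open>\<G>\<^bsub>k+1\<^esub>\<close> and \<open>Gen_Gt k\<close> is the generator \<open>\<G>\<^bsub>k+1\<^esub>\<close> with a tilde, since \<open>\<G>\<^sub>0 = 1\<close> is not a
  generator.\<close>

datatype alt_gen = Gen_W int | Gen_G nat | Gen_Gt nat

type_synonym 'f alt_free = "(alt_gen, 'f) free"

definition fW :: "int \<Rightarrow> 'f::field alt_free"
  where "fW j = generator (Gen_W j)"

definition fG :: "nat \<Rightarrow> 'f::field alt_free"
  where "fG n = (case n of 0 \<Rightarrow> 1 | Suc k \<Rightarrow> generator (Gen_G k))"

definition fGt :: "nat \<Rightarrow> 'f::field alt_free"
  where "fGt n = (case n of 0 \<Rightarrow> 1 | Suc k \<Rightarrow> generator (Gen_Gt k))"

inductive_set alt_relations :: "'f::field \<Rightarrow> ('f alt_free \<times> 'f alt_free) set"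
  for q :: 'f
  where
    W0_Wpos: "(comm free_algebra (fW 0) (fW (int k + 1)),
       (1 - inverse (q ^ 2)) \<odot>\<^bsub>free_algebra\<^esub> (fGt (k + 1) \<ominus>\<^bsub>free_algebra\<^esub> fG (k + 1)))
       \<in> alt_relations q"
  | Wneg_W1: "(comm free_algebra (fW (- int k)) (fW 1),
       (1 - inverse (q ^ 2)) \<odot>\<^bsub>free_algebra\<^esub> (fGt (k + 1) \<ominus>\<^bsub>free_algebra\<^esub> fG (k + 1)))
       \<in> alt_relations q"
  | W0_G: "(qcomm free_algebra q (fW 0) (fG (k + 1)),
       (q - inverse q) \<odot>\<^bsub>free_algebra\<^esub> fW (- int k - 1)) \<in> alt_relations q"
  | Gt_W0: "(qcomm free_algebra q (fGt (k + 1)) (fW 0),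
       (q - inverse q) \<odot>\<^bsub>free_algebra\<^esub> fW (- int k - 1)) \<in> alt_relations q"
  | G_W1: "(qcomm free_algebra q (fG (k + 1)) (fW 1),
       (q - inverse q) \<odot>\<^bsub>free_algebra\<^esub> fW (int k + 2)) \<in> alt_relations q"
  | W1_Gt: "(qcomm free_algebra q (fW 1) (fGt (k + 1)),
       (q - inverse q) \<odot>\<^bsub>free_algebra\<^esub> fW (int k + 2)) \<in> alt_relations q"
  | Wneg_Wneg: "(comm free_algebra (fW (- int k)) (fW (- int l)), 0) \<in> alt_relations q"
  | Wpos_Wpos: "(comm free_algebra (fW (int k + 1)) (fW (int l + 1)), 0) \<in> alt_relations q"
  | Wneg_Wpos: "(comm free_algebra (fW (- int k)) (fW (int l + 1))
       \<oplus>\<^bsub>free_algebra\<^esub> comm free_algebra (fW (int k + 1)) (fW (- int l)), 0) \<in> alt_relations q"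
  | Wneg_G: "(comm free_algebra (fW (- int k)) (fG (l + 1))
       \<oplus>\<^bsub>free_algebra\<^esub> comm free_algebra (fG (k + 1)) (fW (- int l)), 0) \<in> alt_relations q"
  | Wneg_Gt: "(comm free_algebra (fW (- int k)) (fGt (l + 1))
       \<oplus>\<^bsub>free_algebra\<^esub> comm free_algebra (fGt (k + 1)) (fW (- int l)), 0) \<in> alt_relations q"
  | Wpos_G: "(comm free_algebra (fW (int k + 1)) (fG (l + 1))
       \<oplus>\<^bsub>free_algebra\<^esub> comm free_algebra (fG (k + 1)) (fW (int l + 1)), 0) \<in> alt_relations q"
  | Wpos_Gt: "(comm free_algebra (fW (int k + 1)) (fGt (l + 1))
       \<oplus>\<^bsub>free_algebra\<^esub> comm free_algebra (fGt (k + 1)) (fW (int l + 1)), 0) \<in> alt_relations q"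
  | G_G: "(comm free_algebra (fG (k + 1)) (fG (l + 1)), 0) \<in> alt_relations q"
  | Gt_Gt: "(comm free_algebra (fGt (k + 1)) (fGt (l + 1)), 0) \<in> alt_relations q"
  | Gt_G: "(comm free_algebra (fGt (k + 1)) (fG (l + 1))
       \<oplus>\<^bsub>free_algebra\<^esub> comm free_algebra (fG (k + 1)) (fGt (l + 1)), 0) \<in> alt_relations q"

definition alt_algebra :: "'f::field \<Rightarrow> ('f, 'f alt_free set) module"
  where "alt_algebra q = presented_algebra (alt_relations q)"

definition altW :: "'f::field \<Rightarrow> int \<Rightarrow> 'f alt_free set"
  where "altW q j = relation_ideal (alt_relations q) +>\<^bsub>free_algebra\<^esub> fW j"

definition altG :: "'f::field \<Rightarrow> nat \<Rightarrow> 'f alt_free set"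
  where "altG q n = relation_ideal (alt_relations q) +>\<^bsub>free_algebra\<^esub> fG n"

definition altGt :: "'f::field \<Rightarrow> nat \<Rightarrow> 'f alt_free set"
  where "altGt q n = relation_ideal (alt_relations q) +>\<^bsub>free_algebra\<^esub> fGt n"


section \<open>Generating functions\<close>

text \<open>The series \<open>\<Sum>\<^sub>n a\<^sub>n t\<^sup>n\<close> over an algebra is its sequence of coefficients. (The type of formal
  power series in the library takes its coefficients from a type class, not from a ring record.)\<close>

definition series_mult :: "('f, 'a) module \<Rightarrow> (nat \<Rightarrow> 'a) \<Rightarrow> (nat \<Rightarrow> 'a) \<Rightarrow> nat \<Rightarrow> 'a"
  where "series_mult A a b n = (\<Oplus>\<^bsub>A\<^esub>k\<in>{..n}. a k \<otimes>\<^bsub>A\<^esub> b (n - k))"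

definition series_smult :: "('f, 'a) module \<Rightarrow> 'f \<Rightarrow> (nat \<Rightarrow> 'a) \<Rightarrow> nat \<Rightarrow> 'a"
  where "series_smult A c a n = c \<odot>\<^bsub>A\<^esub> a n"

text \<open>The substitution \<open>a(t) \<mapsto> a(c t)\<close>.\<close>

definition series_rescale :: "('f::field, 'a) module \<Rightarrow> 'f \<Rightarrow> (nat \<Rightarrow> 'a) \<Rightarrow> nat \<Rightarrow> 'a"
  where "series_rescale A c a n = c ^ n \<odot>\<^bsub>A\<^esub> a n"


section \<open>The elements \<open>\<Z>\<^sup>\<or>\<^sub>n\<close>\<close>

definition Zvee :: "'f::field \<Rightarrow> nat \<Rightarrow> 'f alt_free set"
  where "Zvee q n =
    (let U = alt_algebra q in
     if n = 0 then \<one>\<^bsub>U\<^esub>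
     else (\<Oplus>\<^bsub>U\<^esub>k\<in>{..n}. q powi (int n - 2 * int k) \<odot>\<^bsub>U\<^esub> (altG q k \<otimes>\<^bsub>U\<^esub> altGt q (n - k)))
       \<ominus>\<^bsub>U\<^esub> q \<odot>\<^bsub>U\<^esub> (\<Oplus>\<^bsub>U\<^esub>k\<in>{..n - 1}. q powi (int n - 1 - 2 * int k) \<odot>\<^bsub>U\<^esub>
             (altW q (- int k) \<otimes>\<^bsub>U\<^esub> altW q (int n - int k))))"


section \<open>Damiani's elements\<close>

text \<open>The recursion is formulated in an arbitrary algebra with two chosen elements \<open>w0\<close>, \<open>w1\<close> in the
  roles of \<open>W\<^sub>0\<close>, \<open>W\<^sub>1\<close>. Algebra homomorphisms respect it, so the image in \<open>\<U>\<^sup>+\<^sub>q\<close> of an element of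
  \<open>U\<^sup>+\<^sub>q\<close> so defined is obtained by running the recursion in \<open>\<U>\<^sup>+\<^sub>q\<close> from \<open>\<W>\<^sub>0\<close>, \<open>\<W>\<^sub>1\<close>. The elements
  \<open>E\<^bsub>n\<delta>+\<alpha>\<^sub>0\<^esub>\<close> do not enter into the \<open>E\<^bsub>n\<delta>\<^esub>\<close>.\<close>

definition damiani_delta1 :: "('f::field, 'a) module \<Rightarrow> 'f \<Rightarrow> 'a \<Rightarrow> 'a \<Rightarrow> 'a"
  where "damiani_delta1 A q w0 w1 =
    inverse (q ^ 2) \<odot>\<^bsub>A\<^esub> (w1 \<otimes>\<^bsub>A\<^esub> w0) \<ominus>\<^bsub>A\<^esub> w0 \<otimes>\<^bsub>A\<^esub> w1"

primrec damiani_alpha1 :: "('f::field, 'a) module \<Rightarrow> 'f \<Rightarrow> 'a \<Rightarrow> 'a \<Rightarrow> nat \<Rightarrow> 'a"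
  where
    "damiani_alpha1 A q w0 w1 0 = w1"
  | "damiani_alpha1 A q w0 w1 (Suc n) = inverse (q + inverse q) \<odot>\<^bsub>A\<^esub>
       comm A (damiani_alpha1 A q w0 w1 n) (damiani_delta1 A q w0 w1)"

fun damiani_delta :: "('f::field, 'a) module \<Rightarrow> 'f \<Rightarrow> 'a \<Rightarrow> 'a \<Rightarrow> nat \<Rightarrow> 'a"
  where
    "damiani_delta A q w0 w1 0 = (- inverse (q - inverse q)) \<odot>\<^bsub>A\<^esub> \<one>\<^bsub>A\<^esub>"
  | "damiani_delta A q w0 w1 (Suc n) =
       inverse (q ^ 2) \<odot>\<^bsub>A\<^esub> (damiani_alpha1 A q w0 w1 n \<otimes>\<^bsub>A\<^esub> w0)
       \<ominus>\<^bsub>A\<^esub> w0 \<otimes>\<^bsub>A\<^esub> damiani_alpha1 A q w0 w1 n"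

definition altE :: "'f::field \<Rightarrow> nat \<Rightarrow> 'f alt_free set"
  where "altE q n = damiani_delta (alt_algebra q) q (altW q 0) (altW q 1) n"

end

theory Submission
  imports Defs "HOL-Computational_Algebra.Formal_Power_Series"
begin

text \<open>The element \<open>\<Z>\<^sup>\<or>\<^sub>1\<close> commutes with \<open>\<W>\<^sub>0\<close> and \<open>\<W>\<^sub>1\<close>, and it is a linear combination of the first
  coefficient \<open>\<G>\<^sub>1\<close> with a tilde, written \<open>g\<close> here, and of \<open>E\<^sub>\<delta>\<close>. Hence the coefficients of
  \<open>X(t) = \<Sum>\<^sub>n E\<^bsub>n\<delta>+\<alpha>\<^sub>1\<^esub> (\<xi>t)\<^sup>n\<close> may be computed with brackets by \<open>g\<close> in place of \<open>E\<^sub>\<delta>\<close>: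
  \<open>X = \<W>\<^sub>1 + t [X, g] / (q - q\<^sup>-\<^sup>1)\<close>. Write \<open>H(t)\<close> for the series \<open>\<G>(t)\<close> with a tilde and
  \<open>W\<^sup>+(t) = \<Sum>\<^sub>n \<W>\<^bsub>n+1\<^esub> t\<^sup>n\<close>, \<open>W\<^sup>-(t) = \<Sum>\<^sub>n \<W>\<^bsub>-n\<^esub> t\<^sup>n\<close>. The defining relations show that
  \<open>Y = W\<^sup>+(qt)\<close> and \<open>Y = X(t) H(qt)\<close> both solve \<open>Y = \<W>\<^sub>1 H(qt) + t [Y, g] / (q - q\<^sup>-\<^sup>1)\<close>, so they
  agree; similarly \<open>W\<^sup>+(q\<^sup>-\<^sup>1t) = H(q\<^sup>-\<^sup>1t) X(t)\<close>. Since \<open>E(\<xi>t)\<close> is linear in \<open>X(t)\<close>, the claim follows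
  by inserting these factorizations in
  \<open>\<Z>\<^sup>\<or>(t) = \<G>(q\<^sup>-\<^sup>1t) H(qt) - q t W\<^sup>-(q\<^sup>-\<^sup>1t) W\<^sup>+(qt)\<close>, after eliminating \<open>\<G>\<close> and \<open>W\<^sup>-\<close> by the
  commutation relations of \<open>\<W>\<^sub>0\<close> with \<open>W\<^sup>+\<close> and \<open>H\<close>.

  Since the algebra is not a type, all computations take place in the free algebra, modulo the
  ideal of relations.\<close>

unbundle fps_syntax

section \<open>Congruence modulo an ideal of an algebra, and power series\<close>

text \<open>Closure of \<open>I\<close> under negation and scaling follows by multiplying with
  \<open>- 1\<close> and \<open>c *s 1\<close>. The ring is arbitrary, so the same calculus applies
  again to power series over it.\<close>

locale algebra_ideal = vector_space scale
  for scale :: "'f::field \<Rightarrow> 'a::ring_1 \<Rightarrow> 'a" (infixr \<open>*s\<close> 75) +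
  fixes I :: "'a set"
  assumes mult_scale_left [simp]: "(c *s x) * y = c *s (x * y)"
    and mult_scale_right [simp]: "x * (c *s y) = c *s (x * y)"
    and zero_mem: "0 \<in> I"
    and add_mem: "x \<in> I \<Longrightarrow> y \<in> I \<Longrightarrow> x + y \<in> I"
    and mult_left_mem: "x \<in> I \<Longrightarrow> a * x \<in> I"
    and mult_right_mem: "x \<in> I \<Longrightarrow> x * a \<in> I"
begin

lemma scale_mem: "x \<in> I \<Longrightarrow> c *s x \<in> I"
  using mult_left_mem[of x "c *s 1"] by simp

lemma uminus_mem: "x \<in> I \<Longrightarrow> - x \<in> I"
  using mult_left_mem[of x "- 1"] by simp

lemma diff_mem: "x \<in> I \<Longrightarrow> y \<in> I \<Longrightarrow> x - y \<in> I"
  using add_mem[of x "- y"] uminus_mem[of y] by simp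

definition cong :: "'a \<Rightarrow> 'a \<Rightarrow> bool" (infix \<open>\<approx>\<close> 50)
  where "x \<approx> y \<longleftrightarrow> x - y \<in> I"

lemma cong_refl [simp]: "x \<approx> x"
  by (simp add: cong_def zero_mem)

lemma cong_sym: "x \<approx> y \<Longrightarrow> y \<approx> x"
  using uminus_mem[of "x - y"] by (simp add: cong_def)

lemma cong_trans [trans]: "x \<approx> y \<Longrightarrow> y \<approx> z \<Longrightarrow> x \<approx> z"
  using add_mem[of "x - y" "y - z"] by (simp add: cong_def)

lemma cong_add: "x \<approx> y \<Longrightarrow> x' \<approx> y' \<Longrightarrow> x + x' \<approx> y + y'"
  using add_mem[of "x - y" "x' - y'"] by (simp add: cong_def algebra_simps)

lemma cong_diff: "x \<approx> y \<Longrightarrow> x' \<approx> y' \<Longrightarrow> x - x' \<approx> y - y'"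
  using diff_mem[of "x - y" "x' - y'"] by (simp add: cong_def algebra_simps)

lemma cong_scale: "x \<approx> y \<Longrightarrow> c *s x \<approx> c *s y"
  using scale_mem[of "x - y" c] by (simp add: cong_def scale_right_diff_distrib)

lemma cong_mult: "x \<approx> y \<Longrightarrow> x' \<approx> y' \<Longrightarrow> x * x' \<approx> y * y'"
  using add_mem[OF mult_right_mem[of "x - y" x'] mult_left_mem[of "x' - y'" y]]
  by (simp add: cong_def algebra_simps)

lemma cong_scale_cancel:
  assumes "c \<noteq> 0" "c *s x \<approx> c *s y"
  shows "x \<approx> y"
  using cong_scale[OF assms(2), of "inverse c"] assms(1) by simp

lemmas cong_intros = cong_refl cong_add cong_diff cong_scale cong_mult

lemma mem_sum: "(\<And>k. k \<in> K \<Longrightarrow> f k \<in> I) \<Longrightarrow> sum f K \<in> I"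
  by (induction K rule: infinite_finite_induct) (auto intro: zero_mem add_mem)

definition fps_scale :: "'f \<Rightarrow> 'a fps \<Rightarrow> 'a fps"
  where "fps_scale c f = Abs_fps (\<lambda>n. c *s (f $ n))"

definition fps_ideal :: "'a fps set"
  where "fps_ideal = {f. \<forall>n. f $ n \<in> I}"

lemma fps_scale_nth [simp]: "fps_scale c f $ n = c *s (f $ n)"
  by (simp add: fps_scale_def)

text \<open>Each coefficient of a product is a finite convolution sum, so the ideal properties of
  \<open>I\<close> pass to \<open>fps_ideal\<close> coefficientwise.\<close>

lemma algebra_ideal_fps: "algebra_ideal fps_scale fps_ideal"
proof unfold_locales
  fix f a :: "'a fps"
  assume "f \<in> fps_ideal"
  then have f: "f $ n \<in> I" for n
    by (simp add: fps_ideal_def)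
  show "a * f \<in> fps_ideal" "f * a \<in> fps_ideal"
    by (simp_all add: fps_ideal_def fps_mult_nth mem_sum mult_left_mem mult_right_mem f)
qed (auto simp: fps_eq_iff fps_mult_nth fps_ideal_def scale_right_distrib scale_left_distrib
    scale_sum_right intro: zero_mem add_mem)

lemma cong_fps_iff: "algebra_ideal.cong fps_ideal f g \<longleftrightarrow> (\<forall>n. f $ n \<approx> g $ n)"
  unfolding algebra_ideal.cong_def[OF algebra_ideal_fps] by (simp add: cong_def fps_ideal_def)

text \<open>The factor \<open>fps_X\<close> makes coefficient \<open>Suc n\<close> of a solution
  depend, modulo \<open>I\<close>, only on \<open>f\<close> and on coefficient \<open>n\<close>; the
  induction starts from \<open>f $ 0\<close>.\<close>

lemma fps_commutator_fixpoint_unique: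
  assumes Y: "algebra_ideal.cong fps_ideal Y
      (f + fps_X * fps_scale c (Y * fps_const h - fps_const h * Y))"
    and Z: "algebra_ideal.cong fps_ideal Z
      (f + fps_X * fps_scale c (Z * fps_const h - fps_const h * Z))"
  shows "algebra_ideal.cong fps_ideal Y Z"
  unfolding cong_fps_iff
proof
  fix n
  show "Y $ n \<approx> Z $ n"
  proof (induction n)
    case 0
    from Y Z have "Y $ 0 \<approx> f $ 0" "Z $ 0 \<approx> f $ 0"
      unfolding cong_fps_iff by (auto dest!: spec[of _ 0])
    then show ?case
      using cong_sym cong_trans by blast
  next
    case (Suc n)
    have "Y $ Suc n \<approx> f $ Suc n + c *s (Y $ n * h - h * Y $ n)"
      using Y unfolding cong_fps_iff by (auto dest!: spec[of _ "Suc n"])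
    also have "\<dots> \<approx> f $ Suc n + c *s (Z $ n * h - h * Z $ n)"
      using Suc by (intro cong_intros)
    also have "\<dots> \<approx> Z $ Suc n"
      using Z unfolding cong_fps_iff by (auto dest!: spec[of _ "Suc n"] intro: cong_sym)
    finally show ?case .
  qed
qed

definition rescale :: "'f \<Rightarrow> (nat \<Rightarrow> 'a) \<Rightarrow> 'a fps"
  where "rescale c a = Abs_fps (\<lambda>n. c ^ n *s a n)"

lemma rescale_nth [simp]: "rescale c a $ n = c ^ n *s a n"
  by (simp add: rescale_def)

end

lemma fps_mult_fps_X_left_commute: "f * (fps_X * g) = fps_X * (f * g)"
  for f g :: "'a::ring_1 fps"
  by (metis fps_mult_fps_X_commute mult.assoc)

section \<open>Consequences of the relations modulo an ideal\<close>

text \<open>\<open>I\<close> is any ideal modulo which the listed relations hold.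
  \<open>q_plus\<close> and \<open>q_minus\<close> make the denominators in Damiani's recursion and
  in \<open>\<xi>\<close> invertible.\<close>

locale alternating = algebra_ideal scale I
  for scale :: "'f::field \<Rightarrow> 'a::ring_1 \<Rightarrow> 'a" (infixr \<open>*s\<close> 75) and I +
  fixes q :: 'f and W :: "int \<Rightarrow> 'a" and G Gt :: "nat \<Rightarrow> 'a"
  assumes q_nonzero: "q \<noteq> 0"
    and q_minus: "q - inverse q \<noteq> 0"
    and q_plus: "q + inverse q \<noteq> 0"
    and G_0: "G 0 = 1"
    and Gt_0: "Gt 0 = 1"
    and W0_W: "W 0 * W (int n + 1) - W (int n + 1) * W 0 \<approx>
      (1 - inverse (q ^ 2)) *s (Gt (Suc n) - G (Suc n))"
    and W0_G: "q *s (W 0 * G (Suc n)) - inverse q *s (G (Suc n) * W 0) \<approx>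
      (q - inverse q) *s W (- int n - 1)"
    and Gt_W0: "q *s (Gt (Suc n) * W 0) - inverse q *s (W 0 * Gt (Suc n)) \<approx>
      (q - inverse q) *s W (- int n - 1)"
    and G_W1: "q *s (G (Suc n) * W 1) - inverse q *s (W 1 * G (Suc n)) \<approx>
      (q - inverse q) *s W (int n + 2)"
    and W1_Gt: "q *s (W 1 * Gt (Suc n)) - inverse q *s (Gt (Suc n) * W 1) \<approx>
      (q - inverse q) *s W (int n + 2)"
    and W_Gt: "W (int k + 1) * Gt (Suc l) - Gt (Suc l) * W (int k + 1)
      + (Gt (Suc k) * W (int l + 1) - W (int l + 1) * Gt (Suc k)) \<approx> 0"
    and Gt_Gt: "Gt (Suc k) * Gt (Suc l) - Gt (Suc l) * Gt (Suc k) \<approx> 0"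
begin

section \<open>Elements commuting with \<open>Z1\<close>, and Damiani's recursion\<close>

text \<open>Modulo \<open>I\<close>, this is \<open>(q - q\<^sup>-\<^sup>1) \<Z>\<^sup>\<or>\<^sub>1\<close> with \<open>G 1\<close> eliminated by means of \<open>W0_W\<close>.\<close>

definition Z1 :: 'a
  where "Z1 = (q ^ 2 - inverse q ^ 2) *s Gt 1 + (W 1 * W 0 - q ^ 2 *s (W 0 * W 1))"

lemma Z1_W0: "Z1 * W 0 \<approx> W 0 * Z1"
proof -
  define p where "p = inverse q"
  have [simp]: "q * p = 1" "p * q = 1" "q * (p * x) = x" "p * (q * x) = x" for x
    using q_nonzero by (simp_all add: p_def)
  define e1 where "e1 = W 0 * W 1 - W 1 * W 0 - (1 - p ^ 2) *s (Gt 1 - G 1)"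
  define e2 where "e2 = q *s (W 0 * G 1) - p *s (G 1 * W 0) - (q - p) *s W (- 1)"
  define e3 where "e3 = q *s (Gt 1 * W 0) - p *s (W 0 * Gt 1) - (q - p) *s W (- 1)"
  have e: "e1 \<in> I" "e2 \<in> I" "e3 \<in> I"
    using W0_W[of 0] W0_G[of 0] Gt_W0[of 0]
    by (simp_all add: cong_def e1_def e2_def e3_def p_def power_inverse)
  \<comment> \<open>An exact identity in the ring: the difference \<open>e3 - e2\<close> removes
    \<open>W (- 1)\<close>, and the two products with \<open>e1\<close> cancel every
    \<open>G 1\<close>.\<close>
  have "Z1 * W 0 - W 0 * Z1 = (q - p) *s (e3 - e2) + q ^ 2 *s (W 0 * e1) - e1 * W 0"
    unfolding Z1_def e1_def e2_def e3_def p_def[symmetric]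
    by (simp add: algebra_simps power2_eq_square)
  also have "\<dots> \<in> I"
    using e by (intro diff_mem add_mem scale_mem mult_left_mem mult_right_mem)
  finally show ?thesis
    by (simp add: cong_def)
qed

lemma Z1_W1: "Z1 * W 1 \<approx> W 1 * Z1"
proof -
  define p where "p = inverse q"
  have [simp]: "q * p = 1" "p * q = 1" "q * (p * x) = x" "p * (q * x) = x" for x
    using q_nonzero by (simp_all add: p_def)
  define e1 where "e1 = W 0 * W 1 - W 1 * W 0 - (1 - p ^ 2) *s (Gt 1 - G 1)"
  define e2 where "e2 = q *s (G 1 * W 1) - p *s (W 1 * G 1) - (q - p) *s W 2"
  define e3 where "e3 = q *s (W 1 * Gt 1) - p *s (Gt 1 * W 1) - (q - p) *s W 2"
  have e: "e1 \<in> I" "e2 \<in> I" "e3 \<in> I"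
    using W0_W[of 0] G_W1[of 0] W1_Gt[of 0]
    by (simp_all add: cong_def e1_def e2_def e3_def p_def power_inverse)
  \<comment> \<open>Here \<open>e3 - e2\<close> removes \<open>W 2\<close>, and the products with
    \<open>e1\<close> again cancel \<open>G 1\<close>.\<close>
  have "Z1 * W 1 - W 1 * Z1 = W 1 * e1 - (q - p) *s (e3 - e2) - q ^ 2 *s (e1 * W 1)"
    unfolding Z1_def e1_def e2_def e3_def p_def[symmetric]
    by (simp add: algebra_simps power2_eq_square)
  also have "\<dots> \<in> I"
    using e by (intro diff_mem add_mem scale_mem mult_left_mem mult_right_mem)
  finally show ?thesis
    by (simp add: cong_def)
qed

text \<open>Together with \<open>alpha1\<close> and \<open>delta\<close>, this repeats Damiani's
  recursion on representatives; the equations hold exactly, not just modulo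
  \<open>I\<close>.\<close>

definition delta1 :: 'a
  where "delta1 = inverse (q ^ 2) *s (W 1 * W 0) - W 0 * W 1"

primrec alpha1 :: "nat \<Rightarrow> 'a"
  where
    "alpha1 0 = W 1"
  | "alpha1 (Suc n) = inverse (q + inverse q) *s (alpha1 n * delta1 - delta1 * alpha1 n)"

fun delta :: "nat \<Rightarrow> 'a"
  where
    "delta 0 = (- inverse (q - inverse q)) *s 1"
  | "delta (Suc n) = inverse (q ^ 2) *s (alpha1 n * W 0) - W 0 * alpha1 n"

text \<open>The elements commuting with \<open>Z1\<close> modulo \<open>I\<close> form a subspace
  closed under products, so commutation with \<open>W 0\<close> and \<open>W 1\<close> extends to
  \<open>delta1\<close> and \<open>alpha1 n\<close>.\<close>

lemma Z1_commute_mult: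
  assumes "Z1 * x \<approx> x * Z1" "Z1 * y \<approx> y * Z1"
  shows "Z1 * (x * y) \<approx> (x * y) * Z1"
proof -
  have "Z1 * (x * y) \<approx> x * Z1 * y"
    using cong_mult[OF assms(1) cong_refl[of y]] by (simp add: mult.assoc)
  also have "x * Z1 * y \<approx> x * y * Z1"
    using cong_mult[OF cong_refl[of x] assms(2)] by (simp add: mult.assoc)
  finally show ?thesis .
qed

lemma Z1_commute_scale: "Z1 * x \<approx> x * Z1 \<Longrightarrow> Z1 * (c *s x) \<approx> (c *s x) * Z1"
  by (simp add: cong_scale)

lemma Z1_commute_diff:
  "Z1 * x \<approx> x * Z1 \<Longrightarrow> Z1 * y \<approx> y * Z1 \<Longrightarrow> Z1 * (x - y) \<approx> (x - y) * Z1"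
  using cong_diff by (simp add: left_diff_distrib right_diff_distrib)

lemma Z1_delta1: "Z1 * delta1 \<approx> delta1 * Z1"
  unfolding delta1_def
  by (intro Z1_commute_diff Z1_commute_scale Z1_commute_mult Z1_W0 Z1_W1)

lemma Z1_alpha1: "Z1 * alpha1 n \<approx> alpha1 n * Z1"
proof (induction n)
  case (Suc n)
  then show ?case
    unfolding alpha1.simps
    by (intro Z1_commute_diff Z1_commute_scale Z1_commute_mult Z1_delta1)
qed (simp add: Z1_W1)

text \<open>The constant that turns the normalization 1/(q + q^-1) of the bracket with
  \<open>delta1\<close> into 1/(q - q^-1) for the bracket with \<open>Gt 1\<close>.\<close>

definition \<xi> :: 'f
  where "\<xi> = - (q ^ 2) * inverse ((q - inverse q) ^ 2)"

text \<open>Since \<open>Z1\<close> commutes with \<open>alpha1 n\<close>, the bracket with \<open>delta1\<close> can be traded for one with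
  \<open>Gt 1\<close>.\<close>

lemma alpha1_Suc_cong:
  "\<xi> *s alpha1 (Suc n) \<approx> inverse (q - inverse q) *s (alpha1 n * Gt 1 - Gt 1 * alpha1 n)"
proof -
  define p where "p = inverse q"
  define d where "d = q - p"
  define s where "s = q + p"
  have nz: "q \<noteq> 0" "d \<noteq> 0" "s \<noteq> 0"
    using q_nonzero q_minus q_plus by (simp_all add: p_def d_def s_def)
  have Z1: "Z1 = (s * d) *s Gt 1 + q ^ 2 *s delta1"
    using nz by (simp add: Z1_def delta1_def s_def d_def p_def algebra_simps power2_eq_square)
  \<comment> \<open>Normalizes the coefficient of \<open>Gt 1\<close> in \<open>Z1\<close> to
    \<open>inverse d\<close>; that of \<open>delta1\<close> then becomes
    \<open>- (\<xi> * inverse s)\<close>.\<close>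
  define k where "k = inverse (s * d) * inverse d"
  have k: "k * (s * d) = inverse d" "k * q ^ 2 = - (\<xi> * inverse s)"
    using nz unfolding k_def \<xi>_def p_def[symmetric] d_def[symmetric]
    by (simp_all add: field_simps power2_eq_square)
  have "inverse d *s (alpha1 n * Gt 1 - Gt 1 * alpha1 n) - \<xi> *s alpha1 (Suc n) =
      (k * (s * d)) *s (alpha1 n * Gt 1 - Gt 1 * alpha1 n)
      + (k * q ^ 2) *s (alpha1 n * delta1 - delta1 * alpha1 n)"
    unfolding k by (simp add: s_def p_def)
  also have "\<dots> = k *s (alpha1 n * Z1 - Z1 * alpha1 n)"
    by (simp add: Z1 scale_right_distrib scale_right_diff_distrib ring_distribs)
  also have "\<dots> \<in> I"
    using cong_sym[OF Z1_alpha1] by (intro scale_mem) (simp add: cong_def)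
  finally show ?thesis
    using cong_sym unfolding cong_def d_def p_def by blast
qed

sublocale fps: algebra_ideal fps_scale fps_ideal
  by (rule algebra_ideal_fps)

notation fps.cong (infix \<open>\<approx>\<^sub>t\<close> 50) and fps_scale (infixr \<open>*\<^sub>t\<close> 75)

section \<open>Fixpoint equations for the generating functions\<close>

abbreviation Wpos :: "'f \<Rightarrow> 'a fps"
  where "Wpos c \<equiv> rescale c (\<lambda>n. W (int n + 1))"

abbreviation Wneg :: "'f \<Rightarrow> 'a fps"
  where "Wneg c \<equiv> rescale c (\<lambda>n. W (- int n))"

text \<open>The instance \<open>l = 0\<close> of \<open>W_Gt\<close>: it shifts the index from
  \<open>Gt\<close> to \<open>W\<close>, so that the bracket is always with the fixed element
  \<open>Gt 1\<close>.\<close>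

lemma W_Gt1_cong:
  "W (int n + 1) * Gt 1 - Gt 1 * W (int n + 1) \<approx> W 1 * Gt (Suc n) - Gt (Suc n) * W 1"
  using W_Gt[of n 0] by (simp add: cong_def algebra_simps)

text \<open>Relation \<open>W1_Gt\<close> with \<open>W 1\<close> collected to the left of
  \<open>Gt (Suc n)\<close>. The bracket left over has coefficient \<open>inverse q\<close>, which
  the substitution of qt for t absorbs.\<close>

lemma Wpos_Suc_cong:
  "(q - inverse q) *s W (int n + 2) \<approx> (q - inverse q) *s (W 1 * Gt (Suc n))
    + inverse q *s (W (int n + 1) * Gt 1 - Gt 1 * W (int n + 1))"
proof -
  have "(q - inverse q) *s W (int n + 2) \<approx>
      q *s (W 1 * Gt (Suc n)) - inverse q *s (Gt (Suc n) * W 1)"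
    by (rule cong_sym[OF W1_Gt])
  also have "\<dots> = (q - inverse q) *s (W 1 * Gt (Suc n))
      + inverse q *s (W 1 * Gt (Suc n) - Gt (Suc n) * W 1)"
    by (simp add: algebra_simps)
  also have "\<dots> \<approx> (q - inverse q) *s (W 1 * Gt (Suc n))
      + inverse q *s (W (int n + 1) * Gt 1 - Gt 1 * W (int n + 1))"
    by (intro cong_add cong_scale cong_refl cong_sym[OF W_Gt1_cong])
  finally show ?thesis .
qed

text \<open>With \<open>W 1\<close> collected on the right the bracket has coefficient
  \<open>q\<close> instead, hence the rescaling by \<open>inverse q\<close> in
  \<open>Wpos_fixpoint'\<close>.\<close>

lemma Wpos_Suc_cong':
  "(q - inverse q) *s W (int n + 2) \<approx> (q - inverse q) *s (Gt (Suc n) * W 1)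
    + q *s (W (int n + 1) * Gt 1 - Gt 1 * W (int n + 1))"
proof -
  have "(q - inverse q) *s W (int n + 2) \<approx>
      q *s (W 1 * Gt (Suc n)) - inverse q *s (Gt (Suc n) * W 1)"
    by (rule cong_sym[OF W1_Gt])
  also have "\<dots> = (q - inverse q) *s (Gt (Suc n) * W 1)
      + q *s (W 1 * Gt (Suc n) - Gt (Suc n) * W 1)"
    by (simp add: algebra_simps)
  also have "\<dots> \<approx> (q - inverse q) *s (Gt (Suc n) * W 1)
      + q *s (W (int n + 1) * Gt 1 - Gt 1 * W (int n + 1))"
    by (intro cong_add cong_scale cong_refl cong_sym[OF W_Gt1_cong])
  finally show ?thesis .
qed

lemma Wpos_fixpoint:
  "Wpos q \<approx>\<^sub>t fps_const (W 1) * rescale q Gt + fps_X * (inverse (q - inverse q) *\<^sub>t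
    (Wpos q * fps_const (Gt 1) - fps_const (Gt 1) * Wpos q))"
  unfolding cong_fps_iff
proof
  fix n
  show "Wpos q $ n \<approx> (fps_const (W 1) * rescale q Gt + fps_X * (inverse (q - inverse q) *\<^sub>t
    (Wpos q * fps_const (Gt 1) - fps_const (Gt 1) * Wpos q))) $ n"
  proof (cases n)
    case (Suc m)
    \<comment> \<open>Clears q - q^-1 and supplies the power of q belonging to coefficient
      \<open>Suc m\<close>; on the bracket, \<open>inverse q\<close> lowers it to the power
      belonging to coefficient \<open>m\<close>.\<close>
    let ?k = "inverse (q - inverse q) * q ^ Suc m"
    have k: "?k * (q - inverse q) = q ^ Suc m" "?k * inverse q = q ^ m * inverse (q - inverse q)"
      using q_minus q_nonzero by (simp_all add: mult_ac)
    show ?thesis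
      using cong_scale[OF Wpos_Suc_cong[of m], of ?k,
          unfolded scale_right_distrib scale_scale k]
      by (simp add: Suc scale_right_diff_distrib add_ac mult_ac)
  qed (simp add: Gt_0)
qed

lemma Wpos_fixpoint':
  "Wpos (inverse q) \<approx>\<^sub>t rescale (inverse q) Gt * fps_const (W 1)
    + fps_X * (inverse (q - inverse q) *\<^sub>t
      (Wpos (inverse q) * fps_const (Gt 1) - fps_const (Gt 1) * Wpos (inverse q)))"
  unfolding cong_fps_iff
proof
  fix n
  show "Wpos (inverse q) $ n \<approx> (rescale (inverse q) Gt * fps_const (W 1)
    + fps_X * (inverse (q - inverse q) *\<^sub>t
      (Wpos (inverse q) * fps_const (Gt 1) - fps_const (Gt 1) * Wpos (inverse q)))) $ n"
  proof (cases n)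
    case (Suc m)
    let ?k = "inverse (q - inverse q) * inverse q ^ Suc m"
    have k: "?k * (q - inverse q) = inverse q ^ Suc m"
      "?k * q = inverse q ^ m * inverse (q - inverse q)"
      using q_minus q_nonzero by (simp_all add: mult_ac)
    show ?thesis
      using cong_scale[OF Wpos_Suc_cong'[of m], of ?k,
          unfolded scale_right_distrib scale_scale k]
      by (simp add: Suc scale_right_diff_distrib add_ac mult_ac)
  qed (simp add: Gt_0)
qed

text \<open>The same bracket operator as in \<open>Wpos_fixpoint\<close>, with inhomogeneous term
  \<open>W 1\<close>; multiplying by a series that commutes with \<open>Gt 1\<close> keeps this
  shape.\<close>

lemma alpha1_fixpoint:
  "rescale \<xi> alpha1 \<approx>\<^sub>t fps_const (W 1) + fps_X * (inverse (q - inverse q) *\<^sub>t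
    (rescale \<xi> alpha1 * fps_const (Gt 1) - fps_const (Gt 1) * rescale \<xi> alpha1))"
  unfolding cong_fps_iff
proof
  fix n
  show "rescale \<xi> alpha1 $ n \<approx> (fps_const (W 1) + fps_X * (inverse (q - inverse q) *\<^sub>t
    (rescale \<xi> alpha1 * fps_const (Gt 1) - fps_const (Gt 1) * rescale \<xi> alpha1))) $ n"
  proof (cases n)
    case (Suc m)
    show ?thesis
      using cong_scale[OF alpha1_Suc_cong[of m], of "\<xi> ^ m"]
      by (simp add: Suc scale_right_diff_distrib mult_ac del: alpha1.simps)
  qed simp
qed

section \<open>The two factorizations of the series of the \<open>W (int n + 1)\<close>\<close>

lemma rescale_Gt_commute:
  "rescale c Gt * fps_const (Gt 1) \<approx>\<^sub>t fps_const (Gt 1) * rescale c Gt"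
  unfolding cong_fps_iff
proof
  fix n
  show "(rescale c Gt * fps_const (Gt 1)) $ n \<approx> (fps_const (Gt 1) * rescale c Gt) $ n"
  proof (cases n)
    case (Suc m)
    show ?thesis
      using cong_scale[OF Gt_Gt[of m 0], of "c ^ n"]
      by (simp add: Suc cong_def scale_right_diff_distrib)
  qed (simp add: Gt_0)
qed

text \<open>Right multiplication by \<open>rescale q Gt\<close>, which commutes with
  \<open>Gt 1\<close>, turns the equation for \<open>rescale \<xi> alpha1\<close> into that for
  \<open>Wpos q\<close>.\<close>

lemma Wpos_factor: "Wpos q \<approx>\<^sub>t rescale \<xi> alpha1 * rescale q Gt"
proof (rule fps_commutator_fixpoint_unique[OF Wpos_fixpoint])
  let ?X = "rescale \<xi> alpha1" and ?G = "rescale q Gt" and ?g = "fps_const (Gt 1)"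
    and ?c = "inverse (q - inverse q)"
  have "?X * ?G \<approx>\<^sub>t (fps_const (W 1) + fps_X * (?c *\<^sub>t (?X * ?g - ?g * ?X))) * ?G"
    by (intro fps.cong_mult fps.cong_refl alpha1_fixpoint)
  also have "\<dots> = fps_const (W 1) * ?G + fps_X * (?c *\<^sub>t (?X * (?g * ?G) - ?g * (?X * ?G)))"
    by (simp add: algebra_simps)
  also have "\<dots> \<approx>\<^sub>t
      fps_const (W 1) * ?G + fps_X * (?c *\<^sub>t (?X * (?G * ?g) - ?g * (?X * ?G)))"
    by (intro fps.cong_intros fps.cong_sym[OF rescale_Gt_commute])
  finally show "?X * ?G \<approx>\<^sub>t
      fps_const (W 1) * ?G + fps_X * (?c *\<^sub>t (?X * ?G * ?g - ?g * (?X * ?G)))"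
    by (simp only: mult.assoc)
qed

text \<open>Left multiplication is the right choice here, since the inhomogeneous term in
  \<open>Wpos_fixpoint'\<close> has \<open>W 1\<close> on the right.\<close>

lemma Wpos_factor':
  "Wpos (inverse q) \<approx>\<^sub>t rescale (inverse q) Gt * rescale \<xi> alpha1"
proof (rule fps_commutator_fixpoint_unique[OF Wpos_fixpoint'])
  let ?X = "rescale \<xi> alpha1" and ?G = "rescale (inverse q) Gt" and ?g = "fps_const (Gt 1)"
    and ?c = "inverse (q - inverse q)"
  have "?G * ?X \<approx>\<^sub>t ?G * (fps_const (W 1) + fps_X * (?c *\<^sub>t (?X * ?g - ?g * ?X)))"
    by (intro fps.cong_mult fps.cong_refl alpha1_fixpoint)
  also have "\<dots> = ?G * fps_const (W 1) + fps_X * (?c *\<^sub>t (?G * ?X * ?g - ?G * ?g * ?X))"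
    by (simp add: algebra_simps fps_mult_fps_X_left_commute)
  also have "\<dots> \<approx>\<^sub>t
      ?G * fps_const (W 1) + fps_X * (?c *\<^sub>t (?G * ?X * ?g - ?g * ?G * ?X))"
    by (intro fps.cong_intros rescale_Gt_commute)
  finally show "?G * ?X \<approx>\<^sub>t
      ?G * fps_const (W 1) + fps_X * (?c *\<^sub>t (?G * ?X * ?g - ?g * (?G * ?X)))"
    by (simp only: mult.assoc)
qed

section \<open>Elimination of \<open>G\<close> and \<open>Wneg\<close>, and the main
  congruence\<close>

lemma Wneg_cong:
  "(q - inverse q) *\<^sub>t Wneg c \<approx>\<^sub>t
    q *\<^sub>t (rescale c Gt * fps_const (W 0)) - inverse q *\<^sub>t (fps_const (W 0) * rescale c Gt)"
  unfolding cong_fps_iff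
proof
  fix n
  show "((q - inverse q) *\<^sub>t Wneg c) $ n \<approx>
    (q *\<^sub>t (rescale c Gt * fps_const (W 0))
      - inverse q *\<^sub>t (fps_const (W 0) * rescale c Gt)) $ n"
  proof (cases n)
    case (Suc m)
    have "- int m - 1 = - int (Suc m)"
      by simp
    with cong_scale[OF cong_sym[OF Gt_W0[of m]], of "c ^ n"] show ?thesis
      by (simp add: Suc scale_right_diff_distrib mult_ac del: of_nat_Suc)
  \<comment> \<open>In the constant coefficient, \<open>Gt 0 = 1\<close> leaves
    \<open>q *s W 0 - inverse q *s W 0\<close>.\<close>
  qed (simp add: Gt_0 scale_left_diff_distrib)
qed

text \<open>The factor 1 - q^-2 in \<open>W0_W\<close> is q^-1 (q - q^-1); this extra q^-1
  compensates the shift by \<open>fps_X\<close>, which is why the series are rescaled by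
  \<open>inverse q\<close>.\<close>

lemma G_cong:
  "(q - inverse q) *\<^sub>t rescale (inverse q) G \<approx>\<^sub>t (q - inverse q) *\<^sub>t rescale (inverse q) Gt
    - fps_X * (fps_const (W 0) * Wpos (inverse q) - Wpos (inverse q) * fps_const (W 0))"
  unfolding cong_fps_iff
proof
  fix n
  show "((q - inverse q) *\<^sub>t rescale (inverse q) G) $ n \<approx>
    ((q - inverse q) *\<^sub>t rescale (inverse q) Gt
      - fps_X * (fps_const (W 0) * Wpos (inverse q) - Wpos (inverse q) * fps_const (W 0))) $ n"
  proof (cases n)
    case (Suc m)
    let ?D = "(q - inverse q) *s inverse q ^ Suc m *s (Gt (Suc m) - G (Suc m))"
    have c: "(q - inverse q) * inverse q ^ Suc m = inverse q ^ m * (1 - inverse (q ^ 2))"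
      using q_nonzero by (simp add: field_simps power2_eq_square)
    have "(q - inverse q) *s inverse q ^ Suc m *s G (Suc m) =
        (q - inverse q) *s inverse q ^ Suc m *s Gt (Suc m) - ?D"
      by (simp add: scale_right_diff_distrib)
    also have "\<dots> \<approx> (q - inverse q) *s inverse q ^ Suc m *s Gt (Suc m)
        - inverse q ^ m *s (W 0 * W (int m + 1) - W (int m + 1) * W 0)"
      unfolding scale_scale c unfolding scale_scale[symmetric]
      by (intro cong_diff cong_refl cong_scale cong_sym[OF W0_W])
    finally show ?thesis
      by (simp add: Suc scale_right_diff_distrib)
  qed (simp add: Gt_0 G_0)
qed

text \<open>Since \<open>delta (Suc n)\<close> is built from \<open>alpha1 n\<close>, passing to
  series costs one factor \<open>fps_X\<close> and one factor \<open>\<xi>\<close>.\<close>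

lemma rescale_delta:
  "rescale \<xi> delta = (- inverse (q - inverse q)) *\<^sub>t 1 + fps_X * (\<xi> *\<^sub>t
    (inverse (q ^ 2) *\<^sub>t (rescale \<xi> alpha1 * fps_const (W 0))
      - fps_const (W 0) * rescale \<xi> alpha1))"
proof (rule fps_ext)
  fix n
  show "rescale \<xi> delta $ n = ((- inverse (q - inverse q)) *\<^sub>t 1 + fps_X * (\<xi> *\<^sub>t
    (inverse (q ^ 2) *\<^sub>t (rescale \<xi> alpha1 * fps_const (W 0))
      - fps_const (W 0) * rescale \<xi> alpha1))) $ n"
    by (cases n) (simp_all add: scale_right_diff_distrib mult_ac)
qed

text \<open>The left side is the generating function of the \<open>Zvee q n\<close> on
  representatives. Both sides reduce to one expression in \<open>W 0\<close>,
  \<open>rescale \<xi> alpha1\<close> and the two rescalings of \<open>Gt\<close>.\<close>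

theorem Zvee_cong:
  "rescale (inverse q) G * rescale q Gt - q *\<^sub>t (fps_X * (Wneg (inverse q) * Wpos q)) \<approx>\<^sub>t
    (- (q - inverse q)) *\<^sub>t (rescale (inverse q) Gt * rescale \<xi> delta * rescale q Gt)"
    (is "?Z \<approx>\<^sub>t ?R")
\<comment> \<open>\<open>G_cong\<close> and \<open>Wneg_cong\<close> are stated for multiples by q -
  q^-1, so both sides are first multiplied by it.\<close>
proof (rule fps.cong_scale_cancel[OF q_minus])
  let ?d = "q - inverse q" and ?w = "fps_const (W 0)" and ?X = "rescale \<xi> alpha1"
    and ?P = "rescale q Gt" and ?M = "rescale (inverse q) Gt"
    and ?Wp = "Wpos q" and ?Wm = "Wpos (inverse q)"
  have \<xi>: "?d * (?d * \<xi>) = - (q ^ 2)"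
  proof -
    have "d * (d * (- (q ^ 2) * inverse (d ^ 2))) = - (q ^ 2)" if "d \<noteq> 0" for d
      using that by (simp add: field_simps power2_eq_square)
    then show ?thesis
      unfolding \<xi>_def using q_minus by blast
  qed
  have d: "- ?d * - inverse ?d = 1"
    unfolding minus_mult_minus using q_minus by (rule right_inverse)
  have Z: "?d *\<^sub>t ?Z = (?d *\<^sub>t rescale (inverse q) G) * ?P
      - q *\<^sub>t (fps_X * ((?d *\<^sub>t Wneg (inverse q)) * ?Wp))"
    by (simp add: fps.scale_right_diff_distrib mult_ac)
  have "?d *\<^sub>t ?R = (- ?d * - inverse ?d) *\<^sub>t ?d *\<^sub>t (?M * ?P)
      + (- (?d * (?d * \<xi>))) *\<^sub>t (fps_X * (inverse (q ^ 2) *\<^sub>t (?M * ?X * ?w * ?P)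
        - ?M * ?w * ?X * ?P))"
  proof -
    have "?M * rescale \<xi> delta * ?P = (- inverse ?d) *\<^sub>t (?M * ?P)
        + \<xi> *\<^sub>t (fps_X * (inverse (q ^ 2) *\<^sub>t (?M * ?X * ?w * ?P) - ?M * ?w * ?X * ?P))"
      unfolding rescale_delta
      by (simp only: distrib_left distrib_right left_diff_distrib right_diff_distrib mult.assoc
          fps_mult_fps_X_left_commute fps.mult_scale_left fps.mult_scale_right mult_1_left)
    then show ?thesis
      by (simp only: fps.scale_right_distrib fps.scale_scale mult_minus_left mult_minus_right mult_ac)
  qed
  also have "\<dots> = ?d *\<^sub>t (?M * ?P) + fps_X * (?M * ?X * ?w * ?P)
      - fps_X * (q ^ 2 *\<^sub>t (?M * ?w * ?X * ?P))"
    unfolding \<xi> d using q_nonzero by (simp add: fps.scale_right_diff_distrib right_diff_distrib)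
  \<comment> \<open>The term \<open>fps_X * (?w * ?M * ?X * ?P)\<close> is added and subtracted, so
    that the patterns of \<open>G_cong\<close> and \<open>Wneg_cong\<close> appear.\<close>
  also have "\<dots> = (?d *\<^sub>t ?M - fps_X * (?w * (?M * ?X) - (?M * ?X) * ?w)) * ?P
      - q *\<^sub>t (fps_X * ((q *\<^sub>t (?M * ?w) - inverse q *\<^sub>t (?w * ?M)) * (?X * ?P)))"
    using q_nonzero
    by (simp add: ring_distribs mult.assoc fps.scale_right_diff_distrib power2_eq_square)
  finally have R: "?d *\<^sub>t ?R =
      (?d *\<^sub>t ?M - fps_X * (?w * (?M * ?X) - (?M * ?X) * ?w)) * ?P
      - q *\<^sub>t (fps_X * ((q *\<^sub>t (?M * ?w) - inverse q *\<^sub>t (?w * ?M)) * (?X * ?P)))" .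
  have "?d *\<^sub>t ?Z \<approx>\<^sub>t (?d *\<^sub>t ?M - fps_X * (?w * ?Wm - ?Wm * ?w)) * ?P
      - q *\<^sub>t (fps_X * ((q *\<^sub>t (?M * ?w) - inverse q *\<^sub>t (?w * ?M)) * ?Wp))"
    unfolding Z by (intro fps.cong_intros G_cong Wneg_cong)
  also have "\<dots> \<approx>\<^sub>t ?d *\<^sub>t ?R"
    unfolding R by (intro fps.cong_intros Wpos_factor Wpos_factor')
  finally show "?d *\<^sub>t ?Z \<approx>\<^sub>t ?d *\<^sub>t ?R" .
qed

end


section \<open>Passage to the presented algebra\<close>

text \<open>As multiplication by a constant on the empty word \<open>0\<close>, scaling inherits its
  laws, and the closure of ideals under it, from the ring.\<close>

definition free_scale :: "'f::field \<Rightarrow> ('g, 'f) free \<Rightarrow> ('g, 'f) free"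
  where "free_scale c x = Poly_Mapping.single 0 c * x"

lemma smult_free_algebra [simp]: "c \<odot>\<^bsub>free_algebra\<^esub> x = free_scale c x"
  by (simp add: free_algebra_def free_scale_def mult_map_scale_conv_mult)

lemma free_algebra_simps [simp]:
  "carrier free_algebra = UNIV" "x \<otimes>\<^bsub>free_algebra\<^esub> y = x * y" "\<one>\<^bsub>free_algebra\<^esub> = 1"
  "\<zero>\<^bsub>free_algebra\<^esub> = 0" "x \<oplus>\<^bsub>free_algebra\<^esub> y = x + y"
  by (simp_all add: free_algebra_def)

text \<open>Constants are central because the empty word is neutral and the field is commutative;
  the induction adds one monomial at a time.\<close>

lemma single_zero_commute:
  "x * Poly_Mapping.single 0 c = Poly_Mapping.single 0 c * x"
  for x :: "('g, 'f::field) free"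
proof (induction x rule: update_induct)
  case (update f a b)
  have "Poly_Mapping.update a b f = f + Poly_Mapping.single a b"
    using update(1) by (intro poly_mapping_eqI)
      (auto simp: lookup_update lookup_add lookup_single in_keys_iff when_def)
  with update show ?case
    by (simp add: distrib_left distrib_right mult_single mult.commute)
qed simp

lemma ring_free_algebra: "ring (free_algebra :: ('f::field, ('g, 'f) free) module)"
proof (rule ringI)
  let ?F = "free_algebra :: ('f, ('g, 'f) free) module"
  show "abelian_group ?F"
  proof (rule abelian_groupI)
    fix x :: "('g, 'f) free"
    show "\<exists>y\<in>carrier free_algebra. y \<oplus>\<^bsub>free_algebra\<^esub> x = \<zero>\<^bsub>free_algebra\<^esub>"
      by (rule bexI[of _ "- x"]) simp_all
  qed (simp_all add: add_ac)
  show "Group.monoid ?F"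
    by (rule monoidI) (auto simp: mult.assoc)
qed (auto simp: distrib_left distrib_right)

interpretation free: ring free_algebra
  by (rule ring_free_algebra)

lemma a_inv_free_algebra [simp]: "\<ominus>\<^bsub>free_algebra\<^esub> x = - x"
  using free.minus_equality[of "- x" x] by simp

lemma a_minus_free_algebra [simp]: "x \<ominus>\<^bsub>free_algebra\<^esub> y = x - y"
  by (simp add: a_minus_def)

lemma comm_free_algebra [simp]: "comm free_algebra x y = x * y - y * x"
  by (simp add: comm_def)

lemma qcomm_free_algebra [simp]:
  "qcomm free_algebra p x y =
    free_scale p (x * y) - free_scale (inverse p) (y * x)"
  by (simp add: qcomm_def)

section \<open>Cosets modulo a relation ideal\<close>

context
  fixes R :: "(('g, 'f::field) free \<times> ('g, 'f) free) set"
begin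

lemma ideal_relation_ideal: "ideal (relation_ideal R) free_algebra"
  unfolding relation_ideal_def by (rule free.genideal_ideal) simp

interpretation rel: ideal "relation_ideal R" free_algebra
  by (rule ideal_relation_ideal)

interpretation rel_quot: ring "free_algebra Quot relation_ideal R"
  by (rule rel.quotient_is_ring)

definition rcls :: "('g, 'f) free \<Rightarrow> ('g, 'f) free set"
  where "rcls x = relation_ideal R +>\<^bsub>free_algebra\<^esub> x"

lemma relation_mem: "(x, y) \<in> R \<Longrightarrow> x - y \<in> relation_ideal R"
  unfolding relation_ideal_def by (rule subsetD[OF free.genideal_self]) auto

lemma algebra_ideal_relation_ideal:
  "algebra_ideal free_scale (relation_ideal R)"
proof (unfold_locales; (unfold free_scale_def)?)
  fix c :: 'f and x y :: "('g, 'f) free"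
  show "x * (Poly_Mapping.single 0 c * y) = Poly_Mapping.single 0 c * (x * y)"
    by (simp only: mult.assoc[symmetric] single_zero_commute[of x])
next
  fix x y :: "('g, 'f) free"
  assume "x \<in> relation_ideal R" "y \<in> relation_ideal R"
  then show "x + y \<in> relation_ideal R"
    using additive_subgroup.a_closed[OF rel.additive_subgroup_axioms, of x y] by simp
next
  fix x a :: "('g, 'f) free"
  assume "x \<in> relation_ideal R"
  then show "a * x \<in> relation_ideal R" "x * a \<in> relation_ideal R"
    using rel.I_l_closed[of x a] rel.I_r_closed[of x a] by simp_all
next
  fix a b :: 'f and x y :: "('g, 'f) free"
  let ?s = "Poly_Mapping.single (0::'g freeword)"
  show "?s a * (x + y) = ?s a * x + ?s a * y"
    by (rule distrib_left)
  show "?s (a + b) * x = ?s a * x + ?s b * x"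
    by (simp only: single_add distrib_right)
  show "?s a * (?s b * x) = ?s (a * b) * x"
    by (simp only: mult.assoc[symmetric] mult_single add_0_left)
  show "?s 1 * x = x"
    by simp
  show "?s a * x * y = ?s a * (x * y)"
    by (rule mult.assoc)
  show "0 \<in> relation_ideal R"
    using additive_subgroup.zero_closed[OF rel.additive_subgroup_axioms] by simp
qed

text \<open>Turns congruence modulo the relation ideal, as in \<open>Zvee_cong\<close>, into
  equality in the presented algebra.\<close>

lemma rcls_eqI:
  assumes "x - y \<in> relation_ideal R"
  shows "rcls x = rcls y"
proof -
  have "x \<in> relation_ideal R +>\<^bsub>free_algebra\<^esub> y"
    using assms by (auto simp: a_r_coset_def' intro!: bexI[of _ "x - y"])
  then show ?thesis
    unfolding rcls_def
    by (intro free.a_repr_independence[symmetric] rel.a_subgroup) simp_all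
qed

text \<open>The presented algebra and the factor ring are records of different types with equal ring
  fields, so the ring axioms are transferred field by field.\<close>

lemma presented_algebra_fields:
  "carrier (presented_algebra R) = carrier (free_algebra Quot relation_ideal R)"
  "monoid.mult (presented_algebra R) = monoid.mult (free_algebra Quot relation_ideal R)"
  "one (presented_algebra R) = one (free_algebra Quot relation_ideal R)"
  "zero (presented_algebra R) = zero (free_algebra Quot relation_ideal R)"
  "add (presented_algebra R) = add (free_algebra Quot relation_ideal R)"
  by (simp_all add: presented_algebra_def quotient_algebra_def)

lemma ring_presented_algebra: "ring (presented_algebra R)"
  by (intro ringI abelian_groupI monoidI; unfold presented_algebra_fields;
      (rule rel_quot.a_closed rel_quot.zero_closed rel_quot.a_assoc rel_quot.a_comm
        rel_quot.l_zero rel_quot.m_closed rel_quot.one_closed rel_quot.m_assoc rel_quot.l_one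
        rel_quot.r_one rel_quot.l_distr rel_quot.r_distr rel_quot.add.l_inv_ex)?; assumption?)

interpretation pres: ring "presented_algebra R"
  by (rule ring_presented_algebra)

lemma rcls_closed [simp]: "rcls x \<in> carrier (presented_algebra R)"
  by (auto simp: presented_algebra_def quotient_algebra_def rcls_def FactRing_def A_RCOSETS_def'
      a_r_coset_def')

lemma rcls_add: "rcls x \<oplus>\<^bsub>presented_algebra R\<^esub> rcls y = rcls (x + y)"
  using rel.a_rcos_sum[of x y]
  by (simp add: presented_algebra_def quotient_algebra_def rcls_def FactRing_def)

lemma rcls_mult: "rcls x \<otimes>\<^bsub>presented_algebra R\<^esub> rcls y = rcls (x * y)"
  using rel.rcoset_mult_add[of x y]
  by (simp add: presented_algebra_def quotient_algebra_def rcls_def FactRing_def)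

lemma rcls_one: "\<one>\<^bsub>presented_algebra R\<^esub> = rcls 1"
  by (simp add: presented_algebra_def quotient_algebra_def rcls_def FactRing_def)

lemma rcls_zero: "\<zero>\<^bsub>presented_algebra R\<^esub> = rcls 0"
  by (simp add: presented_algebra_def quotient_algebra_def rcls_def FactRing_def
      a_r_coset_def')

text \<open>Scaling in the quotient is a union over all representatives. The ideal absorbs the
  constant, so they all give the same coset and the union collapses.\<close>

lemma rcls_smult: "c \<odot>\<^bsub>presented_algebra R\<^esub> rcls x = rcls (free_scale c x)"
proof -
  have const: "rcls (free_scale c y) = rcls (free_scale c x)"
    if "y \<in> rcls x" for y
  proof (rule rcls_eqI)
    from that obtain h where "h \<in> relation_ideal R" "y = h + x"
      by (auto simp: rcls_def a_r_coset_def')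
    then show "free_scale c y - free_scale c x \<in> relation_ideal R"
      using rel.I_l_closed[of h "Poly_Mapping.single 0 c"] by (simp add: free_scale_def distrib_left)
  qed
  have self: "x \<in> rcls x"
    unfolding rcls_def by (rule rel.a_rcos_self) simp
  have "(\<Union>y\<in>rcls x. rcls (free_scale c y)) =
      rcls (free_scale c x)"
    by (rule UN_constant_eq[OF self]) (intro ballI const)
  then show ?thesis
    by (simp add: presented_algebra_def quotient_algebra_def rcls_def)
qed

lemma rcls_minus: "rcls x \<ominus>\<^bsub>presented_algebra R\<^esub> rcls y = rcls (x - y)"
proof -
  have "\<ominus>\<^bsub>presented_algebra R\<^esub> rcls y = rcls (- y)"
    by (rule pres.minus_equality) (simp_all add: rcls_add rcls_zero)
  then show ?thesis
    by (simp add: a_minus_def rcls_add)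
qed

lemma rcls_finsum:
  "finite S \<Longrightarrow> (\<Oplus>\<^bsub>presented_algebra R\<^esub>k\<in>S. rcls (f k)) = rcls (\<Sum>k\<in>S. f k)"
  by (induction S rule: finite_induct)
    (simp_all add: pres.finsum_insert rcls_zero rcls_add Pi_def)

lemmas rcls_simps = rcls_add rcls_minus rcls_mult rcls_smult rcls_one rcls_finsum

end

lemma alternating_relations:
  fixes q :: "'f::field"
  assumes q: "q \<noteq> 0" "\<forall>n>0. q ^ n \<noteq> 1"
  shows "alternating free_scale (relation_ideal (alt_relations q)) q
    fW fG fGt"
proof -
  interpret algebra_ideal free_scale "relation_ideal (alt_relations q)"
    by (rule algebra_ideal_relation_ideal)
  write cong (infix \<open>\<approx>\<close> 50) and free_scale (infixr \<open>*s\<close> 75)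
  have rel: "x \<approx> y" if "(x, y) \<in> alt_relations q" for x y
    using relation_mem[OF that] by (simp add: cong_def)
  \<comment> \<open>The first excludes q = q^-1; the second excludes q = - q^-1, which would give
    q^2 = -1.\<close>
  have "q ^ 2 \<noteq> 1" "q ^ 4 \<noteq> 1"
    using q(2) by simp_all
  note rels = comm_free_algebra qcomm_free_algebra smult_free_algebra a_minus_free_algebra
    free_algebra_simps Suc_eq_plus1[symmetric]
  show ?thesis
  proof unfold_locales
    show "q - inverse q \<noteq> 0"
      using \<open>q ^ 2 \<noteq> 1\<close> q(1) by (simp add: field_simps power2_eq_square)
    show "q + inverse q \<noteq> 0"
    proof
      assume "q + inverse q = 0"
      then have "q ^ 2 = - 1"
        using q(1) by (simp add: field_simps power2_eq_square add_eq_0_iff)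
      then have "q ^ 4 = 1"
        using power_mult[of q 2 2] by simp
      with \<open>q ^ 4 \<noteq> 1\<close> show False ..
    qed
  next
    fix n
    show "fW 0 * fW (int n + 1) - fW (int n + 1) * fW 0 \<approx>
        (1 - inverse (q\<^sup>2)) *s (fGt (Suc n) - fG (Suc n))"
      using rel[OF alt_relations.W0_Wpos] by (simp only: rels)
    show "q *s (fW 0 * fG (Suc n))
        - inverse q *s (fG (Suc n) * fW 0) \<approx>
        (q - inverse q) *s fW (- int n - 1)"
      using rel[OF alt_relations.W0_G] by (simp only: rels)
    show "q *s (fGt (Suc n) * fW 0)
        - inverse q *s (fW 0 * fGt (Suc n)) \<approx>
        (q - inverse q) *s fW (- int n - 1)"
      using rel[OF alt_relations.Gt_W0] by (simp only: rels)
    show "q *s (fG (Suc n) * fW 1)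
        - inverse q *s (fW 1 * fG (Suc n)) \<approx>
        (q - inverse q) *s fW (int n + 2)"
      using rel[OF alt_relations.G_W1] by (simp only: rels)
    show "q *s (fW 1 * fGt (Suc n))
        - inverse q *s (fGt (Suc n) * fW 1) \<approx>
        (q - inverse q) *s fW (int n + 2)"
      using rel[OF alt_relations.W1_Gt] by (simp only: rels)
  next
    fix k l
    show "fW (int k + 1) * fGt (Suc l) - fGt (Suc l) * fW (int k + 1)
        + (fGt (Suc k) * fW (int l + 1) - fW (int l + 1) * fGt (Suc k)) \<approx> 0"
      using rel[OF alt_relations.Wpos_Gt] by (simp only: rels)
    show "fGt (Suc k) * fGt (Suc l) - fGt (Suc l) * fGt (Suc k) \<approx> 0"
      using rel[OF alt_relations.Gt_Gt] by (simp only: rels)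
  qed (simp_all add: q fG_def fGt_def)
qed

theorem proposition11p1:
  fixes q \<xi> :: "'f::field"
  assumes "q \<noteq> 0"
    and "\<forall>n>0. q ^ n \<noteq> 1"
    and "\<xi> = - (q ^ 2) * inverse ((q - inverse q) ^ 2)"
  shows "Zvee q =
    series_smult (alt_algebra q) (- (q - inverse q))
      (series_mult (alt_algebra q)
        (series_mult (alt_algebra q)
          (series_rescale (alt_algebra q) (inverse q) (altGt q))
          (series_rescale (alt_algebra q) \<xi> (altE q)))
        (series_rescale (alt_algebra q) q (altGt q)))"
proof -
  interpret alternating free_scale "relation_ideal (alt_relations q)" q
    fW fG fGt
    by (rule alternating_relations[OF assms(1,2)])
  write free_scale (infixr \<open>*s\<close> 75) and fps_scale (infixr \<open>*\<^sub>t\<close> 75)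
  define cls where "cls = rcls (alt_relations q)"
  note cls_simps = rcls_simps[where R = "alt_relations q", folded alt_algebra_def cls_def]
  have gens: "altW q j = cls (fW j)" "altG q n = cls (fG n)" "altGt q n = cls (fGt n)" for j n
    by (simp_all add: altW_def altG_def altGt_def cls_def rcls_def)
  have \<xi>: "\<xi> = local.\<xi>"
    by (simp add: assms(3) \<xi>_def)
  have alpha1: "damiani_alpha1 (alt_algebra q) q (altW q 0) (altW q 1) n = cls (alpha1 n)" for n
    by (induction n) (simp_all add: gens cls_simps comm_def damiani_delta1_def delta1_def)
  have E: "altE q n = cls (delta n)" for n
    unfolding altE_def
    by (cases n) (simp_all only: damiani_delta.simps delta.simps gens alpha1[unfolded gens] cls_simps)
  \<comment> \<open>With \<open>mult\<close> and \<open>smult\<close>, this moves every series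
    operation to representatives, so the right side of the claim becomes the coset sequence of a
    single series.\<close>
  have rescale: "series_rescale (alt_algebra q) c (\<lambda>n. cls (a n)) = (\<lambda>n. cls (rescale c a $ n))"
    for c a
    by (simp add: series_rescale_def cls_simps fun_eq_iff)
  have mult: "series_mult (alt_algebra q) (\<lambda>n. cls (f $ n)) (\<lambda>n. cls (g $ n)) =
      (\<lambda>n. cls ((f * g) $ n))" for f g
    by (simp add: series_mult_def cls_simps fun_eq_iff fps_mult_nth atMost_atLeast0)
  have smult: "series_smult (alt_algebra q) c (\<lambda>n. cls (f $ n)) = (\<lambda>n. cls ((c *\<^sub>t f) $ n))"
    for c f
    by (simp add: series_smult_def cls_simps fun_eq_iff)
  let ?Z = "rescale (inverse q) fG * rescale q fGt
    - q *\<^sub>t (fps_X * (Wneg (inverse q) * Wpos q))"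
  have Z: "Zvee q n = cls (?Z $ n)" for n
  proof (cases n)
    case 0
    then show ?thesis
      by (simp add: Zvee_def cls_simps G_0 Gt_0)
  next
    case (Suc m)
    then have n: "n \<noteq> 0" "n - 1 = m" "int n - 1 = int m"
      by simp_all
    \<comment> \<open>Splits the exponent i - 2k as (i - k) - k, matching the rescalings by
      \<open>inverse q\<close> and \<open>q\<close> of the two factors; used for
      \<open>i = n\<close> and \<open>i = m\<close>.\<close>
    have powi: "q powi (int i - 2 * int k) = inverse q ^ k * q ^ (i - k)" if "k \<le> i" for i k
    proof -
      have "q powi (int i - 2 * int k) = q powi (int (i - k) - int k)"
        using that by (simp add: of_nat_diff)
      also have "\<dots> = q powi int (i - k) / q powi int k"
        by (rule power_int_diff) (simp add: assms(1))
      finally show ?thesis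
        by (simp add: divide_inverse power_inverse mult.commute)
    qed
    have "Zvee q n = cls ((\<Sum>k\<le>n. q powi (int n - 2 * int k) *s
          (fG k * fGt (n - k)))
        - q *s (\<Sum>k\<le>m. q powi (int m - 2 * int k) *s
          (fW (- int k) * fW (int n - int k))))"
      by (simp only: Zvee_def Let_def n if_False gens cls_simps finite_atMost)
    also have "(\<Sum>k\<le>n. q powi (int n - 2 * int k) *s (fG k * fGt (n - k))) =
        (rescale (inverse q) fG * rescale q fGt) $ n"
      unfolding fps_mult_nth atMost_atLeast0
      by (intro sum.cong refl) (simp add: powi)
    also have "(\<Sum>k\<le>m. q powi (int m - 2 * int k) *s
          (fW (- int k) * fW (int n - int k))) = (Wneg (inverse q) * Wpos q) $ m"
    proof -
      \<comment> \<open>Coefficient \<open>m - k\<close> of \<open>Wpos q\<close> carries the index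
        n - k because n = m + 1; the factor \<open>fps_X\<close> makes up for the missing
        degree.\<close>
      have "int n - int k = int (m - k) + 1" if "k \<le> m" for k
        using that Suc by simp
      then show ?thesis
        unfolding fps_mult_nth atMost_atLeast0
        by (intro sum.cong refl) (simp add: powi mult.commute[of "q ^ (m - k)" for k] del: of_nat_diff)
    qed
    finally show ?thesis
      using Suc by simp
  qed
  have "Zvee q = (\<lambda>n. cls (((- (q - inverse q)) *\<^sub>t
      (rescale (inverse q) fGt * rescale \<xi> delta * rescale q fGt)) $ n))"
    using Zvee_cong unfolding \<xi> cong_fps_iff cong_def
    by (intro ext) (simp only: Z cls_def rcls_eqI)
  moreover have "altGt q = (\<lambda>n. cls (fGt n))" "altE q = (\<lambda>n. cls (delta n))"
    using gens E by auto
  ultimately show ?thesis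
    by (simp only: rescale mult smult)
qed

end
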